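(* Let $H=(H^\bullet,H^\times)$ be a hypergraph and $\mathcal{H}$ the set of its subhypergraphs. For all $X,Y\in\mathcal{H}$, $[\delta,\Delta](X)\subseteq Y$ if and only if $X\subseteq[\epsilon,\varepsilon](Y)$; that is, $([\epsilon,\varepsilon],[\delta,\Delta])$ is an adjunction on $(\mathcal{H},\subseteq)$.
   Context: A hypergraph is a pair $H=(H^\bullet,H^\times)$ where $H^\bullet$ is a set of vertices and $H^\times=(e_i)_{i\in I}$ is a family of hyperedges indexed by a finite set $I$, each hyperedge $e$ having a vertex set $v(e)\subseteq H^\bullet$. Subsets of $H^\times$ are subfamilies $X^\times=(e_j)_{j\in J}$, $J\subseteq I$. A subhypergraph of $H$ is a pair $X=(X^\bullet,X^\times)$ with $X^\bullet\subseteq H^\bullet$, $X^\times\subseteq H^\times$ and $v(e)\subseteq X^\bullet$ for every $e\in X^\times$; $X\subseteq Y$ means componentwise inclusion. Operators: $\delta^\bullet(X^\times)=\bigcup_{j\in J}v(e_j)$; $\epsilon^\bullet(X^\times)=\bigcap_{i\in I\setminus J}\overline{v(e_i)}$ (complement in $H^\bullet$); $\epsilon^\times(X^\bullet)=\{e_i\mid v(e_i)\subseteq X^\bullet\}$; $\delta^\times(X^\bullet)=\{e_i\mid v(e_i)\cap X^\bullet\neq\emptyset\}$; $\delta=\delta^\bullet\circ\delta^\times$, $\epsilon=\epsilon^\bullet\circ\epsilon^\times$; $\Delta=\delta^\times\circ\delta^\bullet$, $\varepsilon=\epsilon^\times\circ\epsilon^\bullet$; $[\delta,\Delta](X)=(\delta(X^\bullet),\Delta(X^\times))$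 and $[\epsilon,\varepsilon](X)=(\epsilon(X^\bullet),\varepsilon(X^\times))$. *)

theory Defs
  imports "HOL-Algebra.Galois_Connection" "HOL-Library.Product_Order"
begin

text \<open>
  Hyperedges are represented by their indices, so that a subfamily of the hyperedges is a set of
  indices, and distinct hyperedges may have the same (possibly empty) vertex set.
\<close>

record ('v, 'i) hypergraph =
  verts :: "'v set"
  edges :: "'i set"
  vset :: "'i \<Rightarrow> 'v set"

definition is_hypergraph :: "('v, 'i) hypergraph \<Rightarrow> bool" where
  "is_hypergraph H \<longleftrightarrow> finite (edges H) \<and> (\<forall>i\<in>edges H. vset H i \<subseteq> verts H)"

text \<open>
  On pairs of a vertex set and a set of indices, the componentwise inclusion is the order
  \<open>\<le>\<close> of the product type.
\<close>

definition subhypergraphs :: "('v, 'i) hypergraph \<Rightarrow> ('v set \<times> 'i set) set" where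
  "subhypergraphs H =
     {(A, J). A \<subseteq> verts H \<and> J \<subseteq> edges H \<and> (\<forall>j\<in>J. vset H j \<subseteq> A)}"

text \<open>
  Correspondence of names (dilations are \<open>\<delta>\<close>, erosions \<open>\<epsilon>\<close>; the suffix tells the values,
  \<open>v\<close> for vertices, \<open>e\<close> for hyperedges): \<open>dil_v\<close> is \<open>\<delta>\<^sup>\<bullet>\<close>, \<open>ero_v\<close> is \<open>\<epsilon>\<^sup>\<bullet>\<close>, \<open>ero_e\<close> is \<open>\<epsilon>\<^sup>\<times>\<close>,
  \<open>dil_e\<close> is \<open>\<delta>\<^sup>\<times>\<close>; \<open>dil_vv\<close> and \<open>dil_ee\<close> are \<open>\<delta>\<close> and \<open>\<Delta>\<close>, and \<open>ero_vv\<close> and \<open>ero_ee\<close> are the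
  erosions adjoint to them.
\<close>

definition dil_v :: "('v, 'i) hypergraph \<Rightarrow> 'i set \<Rightarrow> 'v set" where
  "dil_v H J = (\<Union>j\<in>J. vset H j)"

text \<open>
  Intersecting with \<open>verts H\<close> makes the empty intersection, which arises for
  \<open>J = edges H\<close>, equal to \<open>verts H\<close>.
\<close>

definition ero_v :: "('v, 'i) hypergraph \<Rightarrow> 'i set \<Rightarrow> 'v set" where
  "ero_v H J = verts H \<inter> (\<Inter>i\<in>edges H - J. verts H - vset H i)"

definition ero_e :: "('v, 'i) hypergraph \<Rightarrow> 'v set \<Rightarrow> 'i set" where
  "ero_e H A = {i \<in> edges H. vset H i \<subseteq> A}"

definition dil_e :: "('v, 'i) hypergraph \<Rightarrow> 'v set \<Rightarrow> 'i set" where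
  "dil_e H A = {i \<in> edges H. vset H i \<inter> A \<noteq> {}}"

definition dil_vv :: "('v, 'i) hypergraph \<Rightarrow> 'v set \<Rightarrow> 'v set" where
  "dil_vv H = dil_v H \<circ> dil_e H"

definition ero_vv :: "('v, 'i) hypergraph \<Rightarrow> 'v set \<Rightarrow> 'v set" where
  "ero_vv H = ero_v H \<circ> ero_e H"

definition dil_ee :: "('v, 'i) hypergraph \<Rightarrow> 'i set \<Rightarrow> 'i set" where
  "dil_ee H = dil_e H \<circ> dil_v H"

definition ero_ee :: "('v, 'i) hypergraph \<Rightarrow> 'i set \<Rightarrow> 'i set" where
  "ero_ee H = ero_e H \<circ> ero_v H"

definition dilation :: "('v, 'i) hypergraph \<Rightarrow> 'v set \<times> 'i set \<Rightarrow> 'v set \<times> 'i set" where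
  "dilation H X = (dil_vv H (fst X), dil_ee H (snd X))"

definition erosion :: "('v, 'i) hypergraph \<Rightarrow> 'v set \<times> 'i set \<Rightarrow> 'v set \<times> 'i set" where
  "erosion H X = (ero_vv H (fst X), ero_ee H (snd X))"

definition subhypergraph_order :: "('v, 'i) hypergraph \<Rightarrow> ('v set \<times> 'i set) gorder" where
  "subhypergraph_order H = \<lparr>carrier = subhypergraphs H, eq = (=), le = (\<le>)\<rparr>"

end

theory Submission
  imports Defs
begin

text \<open>
  Each of the pairs (\<open>dil_v\<close>, \<open>ero_e\<close>) and (\<open>dil_e\<close>, \<open>ero_v\<close>) is adjoint between vertex sets and
  sets of hyperedges, so the two composites are adjoint as well, and the adjunction of pairs holds
  componentwise. What remains is that both maps send subhypergraphs to subhypergraphs; for the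
  erosion, a hyperedge \<open>j\<close> inside \<open>ero_v H J\<close> is disjoint from every hyperedge outside \<open>J\<close>, hence
  from every hyperedge not contained in \<open>A\<close>.
\<close>

lemma dil_v_subset_iff:
  assumes "J \<subseteq> edges H"
  shows "dil_v H J \<subseteq> A \<longleftrightarrow> J \<subseteq> ero_e H A"
  using assms unfolding dil_v_def ero_e_def by blast

text \<open>Both sides say that every hyperedge outside \<open>J\<close> is disjoint from
  \<open>A\<close>; the assumption on \<open>A\<close> is there because \<open>ero_v\<close> takes
  its values within \<open>verts H\<close>.\<close>

lemma dil_e_subset_iff:
  assumes "A \<subseteq> verts H"
  shows "dil_e H A \<subseteq> J \<longleftrightarrow> A \<subseteq> ero_v H J"
  using assms unfolding dil_e_def ero_v_def by blast

lemma dil_e_subset_edges: "dil_e H A \<subseteq> edges H"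
  unfolding dil_e_def by blast

lemma ero_v_subset_verts: "ero_v H J \<subseteq> verts H"
  unfolding ero_v_def by blast

lemma dil_v_subset_verts:
  assumes "is_hypergraph H" "J \<subseteq> edges H"
  shows "dil_v H J \<subseteq> verts H"
  using assms unfolding is_hypergraph_def dil_v_def by blast

lemma dil_vv_subset_iff:
  assumes "A \<subseteq> verts H"
  shows "dil_vv H A \<subseteq> B \<longleftrightarrow> A \<subseteq> ero_vv H B"
  unfolding dil_vv_def ero_vv_def comp_apply
  using dil_v_subset_iff[OF dil_e_subset_edges] dil_e_subset_iff[OF assms] by metis

text \<open>The set passed to \<open>dil_e\<close> is now \<open>dil_v H J\<close>, and
  \<open>is_hypergraph H\<close> places it within \<open>verts H\<close>.\<close>

lemma dil_ee_subset_iff: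
  assumes "is_hypergraph H" "J \<subseteq> edges H"
  shows "dil_ee H J \<subseteq> K \<longleftrightarrow> J \<subseteq> ero_ee H K"
  unfolding dil_ee_def ero_ee_def comp_apply
  using dil_e_subset_iff[OF dil_v_subset_verts[OF assms]] dil_v_subset_iff[OF assms(2)] by metis

lemma dilation_in_subhypergraphs:
  assumes "is_hypergraph H" "X \<in> subhypergraphs H"
  shows "dilation H X \<in> subhypergraphs H"
proof -
  obtain A J where X: "X = (A, J)" by (cases X)
  have "dil_v H J \<subseteq> A"
    using assms(2) unfolding X subhypergraphs_def dil_v_def by blast
  \<comment> \<open>A hyperedge meeting \<open>dil_v H J\<close> also meets \<open>A\<close>, so it
    is one of those whose union is \<open>dil_vv H A\<close>.\<close>
  then have "\<forall>j\<in>dil_ee H J. vset H j \<subseteq> dil_vv H A"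
    unfolding dil_ee_def dil_vv_def dil_e_def dil_v_def comp_apply by blast
  moreover have "dil_vv H A \<subseteq> verts H"
    unfolding dil_vv_def by (simp add: dil_v_subset_verts dil_e_subset_edges assms(1))
  moreover have "dil_ee H J \<subseteq> edges H"
    unfolding dil_ee_def by (simp add: dil_e_subset_edges)
  ultimately show ?thesis
    unfolding X dilation_def subhypergraphs_def by simp
qed

lemma erosion_in_subhypergraphs:
  assumes "X \<in> subhypergraphs H"
  shows "erosion H X \<in> subhypergraphs H"
proof -
  obtain A J where X: "X = (A, J)" by (cases X)
  have "J \<subseteq> ero_e H A"
    using assms unfolding X subhypergraphs_def ero_e_def by blast
  \<comment> \<open>\<open>ero_v H\<close> is monotone: enlarging the family leaves fewer hyperedges
    to avoid.\<close>
  then have "ero_v H J \<subseteq> ero_vv H A"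
    unfolding ero_vv_def ero_v_def comp_apply by blast
  then have "\<forall>j\<in>ero_ee H J. vset H j \<subseteq> ero_vv H A"
    unfolding ero_ee_def ero_e_def by auto
  moreover have "ero_vv H A \<subseteq> verts H"
    unfolding ero_vv_def by (simp add: ero_v_subset_verts)
  moreover have "ero_ee H J \<subseteq> edges H"
    unfolding ero_ee_def ero_e_def by auto
  ultimately show ?thesis
    unfolding X erosion_def subhypergraphs_def by simp
qed

lemma dilation_le_iff:
  assumes "is_hypergraph H" "X \<in> subhypergraphs H"
  shows "dilation H X \<le> Y \<longleftrightarrow> X \<le> erosion H Y"
proof -
  have "fst X \<subseteq> verts H" "snd X \<subseteq> edges H"
    using assms(2) unfolding subhypergraphs_def by auto
  then show ?thesis
    by (simp add: dilation_def erosion_def less_eq_prod_def dil_vv_subset_iff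
        dil_ee_subset_iff assms(1))
qed

lemma partial_order_subhypergraph_order: "partial_order (subhypergraph_order H)"
  by unfold_locales (auto simp: subhypergraph_order_def)

theorem theorem2:
  fixes H :: "('v, 'i) hypergraph"
  assumes "is_hypergraph H"
  shows "(\<forall>X\<in>subhypergraphs H. \<forall>Y\<in>subhypergraphs H.
            dilation H X \<le> Y \<longleftrightarrow> X \<le> erosion H Y) \<and>
         galois_connection
           \<lparr>orderA = subhypergraph_order H, orderB = subhypergraph_order H,
            lower = dilation H, upper = erosion H\<rparr>"
proof (intro conjI ballI)
  show "dilation H X \<le> Y \<longleftrightarrow> X \<le> erosion H Y"
    if "X \<in> subhypergraphs H" for X Y
    using assms that by (rule dilation_le_iff)
  show "galois_connection
          \<lparr>orderA = subhypergraph_order H, orderB = subhypergraph_order H,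
           lower = dilation H, upper = erosion H\<rparr>"
    \<comment> \<open>Besides the order and the equivalence, a Galois connection requires both maps
      to preserve the carrier, hence the two closure lemmas.\<close>
    using partial_order_subhypergraph_order[of H]
    by (simp add: galois_connection_def galois_connection_axioms_def connection_def
        subhypergraph_order_def dilation_in_subhypergraphs erosion_in_subhypergraphs
        dilation_le_iff assms)
qed

end
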